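(* Let $\Phi$ be a finite set of linear transformations mapping $\Delta^n$ to $\Delta^n$. Let $F:\mathbb{R}^{|\Phi|}\to\mathbb{R}$ be a convex differentiable function such that $F(s)\le 0$ for all $s\in\mathbb{R}^{|\Phi|}_{\le 0}$, and such that $F$ is positive invariant and smooth with constant $L>0$, i.e. $F((x+y)^+)\le F(x)+\langle\nabla F(x),y\rangle+\frac{L}{2}\|y\|^2$ for all $x,y\in\mathbb{R}^{|\Phi|}$. Let $\eta_1\ge\eta_2\ge\dots\ge\eta_T>0$ be step sizes. Then for every sequence of losses $\ell_1,\dots,\ell_T\in\mathbb{R}^n$ and predictions $m_1,\dots,m_T\in\mathbb{R}^{|\Phi|}$, if in each round $t$ the algorithm plays a fixed point $x_t\in\Delta^n$ of the operator $\tilde M_t^{\Phi+}$ (an arbitrary $x_t\in\Delta^n$ if the denominator defining $\tilde M_t^{\Phi+}$ is zero), then $$F(\eta_T s^{\Phi+}_{1:T})\le\frac{L}{2}\sum_{t=1}^T\eta_T\,\eta_t\,\|s^{\Phi}_t-m_t\|^2 .$$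
   Context: $\Delta^n\subset\mathbb{R}^n$ is the probability simplex over $n$ actions. $\|\cdot\|$ is a norm on $\mathbb{R}^{|\Phi|}$, vectors in $\mathbb{R}^{|\Phi|}$ are indexed by $\phi\in\Phi$, $\mathbf 1=(1,\dots,1)\in\mathbb{R}^{|\Phi|}$, $\mathbb{R}^{|\Phi|}_{\le 0}$ is the set of vectors with all entries nonpositive, and $(v)^+$ denotes the vector obtained from $v$ by replacing every negative entry by $0$. Learning with expert advice: in each round $t=1,\dots,T$ the algorithm selects $x_t\in\Delta^n$, and then a loss vector $\ell_t\in\mathbb{R}^n$ (arbitrary, possibly chosen adversarially after seeing $x_t$) is revealed. Define $s_t^\Phi=\big(\langle\ell_t,x_t\rangle-\langle\ell_t,\phi(x_t)\rangle\big)_{\phi\in\Phi}\in\mathbb{R}^{|\Phi|}$, and the modified regret vector $s^{\Phi+}_{1:0}=0$, $s^{\Phi+}_{1:t}=(s^{\Phi+}_{1:t-1}+s^\Phi_t)^+$. In round $t$, a prediction $m_t\in\mathbb{R}^{|\Phi|}$ is available before $x_t$ is chosen, and with $g_t=\nabla F(\eta_t(s^{\Phi+}_{1:t-1}+m_t))$ the operator (optimistic Lagrangian hedging+) is $$\tilde M_t^{\Phi+}(x)=\frac{\sum_{\phi\in\Phi}(g_t)_\phi\,\phi(x)}{\langle g_t,\mathbf 1\rangle}.$$ *)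

theory Defs
  imports "HOL-Analysis.Analysis"
begin

definition prob_simplex :: "(real ^ 'n) set" where
  "prob_simplex = {x. (\<forall>i. 0 \<le> x $ i) \<and> (\<Sum>i\<in>UNIV. x $ i) = 1}"

(* An arbitrary norm on the space, in general different from the Euclidean norm of the type class. *)
definition is_norm :: "('v::real_vector \<Rightarrow> real) \<Rightarrow> bool" where
  "is_norm N \<longleftrightarrow>
     (\<forall>x. 0 \<le> N x) \<and> (\<forall>x. N x = 0 \<longleftrightarrow> x = 0) \<and>
     (\<forall>c x. N (c *\<^sub>R x) = \<bar>c\<bar> * N x) \<and> (\<forall>x y. N (x + y) \<le> N x + N y)"

definition pos_part :: "real ^ 'k \<Rightarrow> real ^ 'k" where
  "pos_part v = (\<chi> i. max 0 (v $ i))"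

definition gradient :: "('v::real_inner \<Rightarrow> real) \<Rightarrow> 'v \<Rightarrow> 'v" where
  "gradient F x = (THE D. GDERIV F x :> D)"

lemma gradient_eqI:
  assumes "GDERIV F x :> D"
  shows "gradient F x = D"
  unfolding gradient_def
proof (rule the_equality)
  show "GDERIV F x :> D" by (fact assms)
next
  fix D' assume "GDERIV F x :> D'"
  with assms have "(\<lambda>h. h \<bullet> D') = (\<lambda>h. h \<bullet> D)"
    unfolding gderiv_def by (rule has_derivative_unique[rotated])
  then have "h \<bullet> D' = h \<bullet> D" for h
    by meson
  then show "D' = D"
    using vector_eq_ldot by blast
qed

lemma GDERIV_gradient:
  fixes F :: "'v::euclidean_space \<Rightarrow> real"
  assumes "F differentiable (at x)"
  shows "GDERIV F x :> gradient F x"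
proof -
  obtain F' where F': "(F has_derivative F') (at x)"
    using assms by (auto simp: differentiable_def)
  then have lin: "linear F'"
    by (rule has_derivative_linear)
  have "F' h = h \<bullet> adjoint F' 1" for h
    using adjoint_works[OF lin, of h 1] by simp
  then have "F' = (\<lambda>h. h \<bullet> adjoint F' 1)"
    by blast
  then have "GDERIV F x :> adjoint F' 1"
    using F' by (simp add: gderiv_def)
  then show ?thesis
    using gradient_eqI by metis
qed

definition positive_invariant_smooth ::
    "(real ^ 'k \<Rightarrow> real) \<Rightarrow> real \<Rightarrow> (real ^ 'k \<Rightarrow> real) \<Rightarrow> bool" where
  "positive_invariant_smooth N L F \<longleftrightarrow>
     (\<forall>x y. F (pos_part (x + y)) \<le> F x + gradient F x \<bullet> y + L / 2 * (N y)\<^sup>2)"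

(* The finite set Phi of transformations is given by an enumeration phi over a finite
   type 'k, so that the vectors indexed by Phi are the elements of real ^ 'k. *)

definition inst_regret ::
    "('k::finite \<Rightarrow> real ^ 'n \<Rightarrow> real ^ 'n) \<Rightarrow> real ^ 'n \<Rightarrow> real ^ 'n \<Rightarrow> real ^ 'k" where
  "inst_regret phi l x = (\<chi> k. l \<bullet> x - l \<bullet> phi k x)"

(* Rounds are numbered from 1: the values l 0 and x 0 are never used. *)
primrec mod_regret ::
    "('k::finite \<Rightarrow> real ^ 'n \<Rightarrow> real ^ 'n) \<Rightarrow> (nat \<Rightarrow> real ^ 'n) \<Rightarrow> (nat \<Rightarrow> real ^ 'n)
      \<Rightarrow> nat \<Rightarrow> real ^ 'k" where
  "mod_regret phi l x 0 = 0"
| "mod_regret phi l x (Suc t) =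
     pos_part (mod_regret phi l x t + inst_regret phi (l (Suc t)) (x (Suc t)))"

definition hedging_grad ::
    "('k::finite \<Rightarrow> real ^ 'n \<Rightarrow> real ^ 'n) \<Rightarrow> (real ^ 'k \<Rightarrow> real) \<Rightarrow> (nat \<Rightarrow> real)
      \<Rightarrow> (nat \<Rightarrow> real ^ 'n) \<Rightarrow> (nat \<Rightarrow> real ^ 'k) \<Rightarrow> (nat \<Rightarrow> real ^ 'n) \<Rightarrow> nat \<Rightarrow> real ^ 'k" where
  "hedging_grad phi F \<eta> l m x t = gradient F (\<eta> t *\<^sub>R (mod_regret phi l x (t - 1) + m t))"

definition hedging_op ::
    "('k::finite \<Rightarrow> real ^ 'n \<Rightarrow> real ^ 'n) \<Rightarrow> real ^ 'k \<Rightarrow> real ^ 'n \<Rightarrow> real ^ 'n" where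
  "hedging_op phi g y = (\<Sum>k\<in>UNIV. (g $ k) *\<^sub>R phi k y) /\<^sub>R (g \<bullet> vec 1)"

definition plays_optimistic_hedging_plus ::
    "('k::finite \<Rightarrow> real ^ 'n \<Rightarrow> real ^ 'n) \<Rightarrow> (real ^ 'k \<Rightarrow> real) \<Rightarrow> (nat \<Rightarrow> real) \<Rightarrow> nat
      \<Rightarrow> (nat \<Rightarrow> real ^ 'n) \<Rightarrow> (nat \<Rightarrow> real ^ 'k) \<Rightarrow> (nat \<Rightarrow> real ^ 'n) \<Rightarrow> bool" where
  "plays_optimistic_hedging_plus phi F \<eta> T l m x \<longleftrightarrow>
     (\<forall>t\<in>{1..T}. x t \<in> prob_simplex \<and>
        (hedging_grad phi F \<eta> l m x t \<bullet> vec 1 \<noteq> 0 \<longrightarrow>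
           hedging_op phi (hedging_grad phi F \<eta> l m x t) (x t) = x t))"

end

(* The positive part commutes with scaling by eta_t > 0, so smoothness at
   eta_t (s_{1:t-1} + m_t) bounds F (eta_t s_{1:t}), and the tangent inequality for the convex F
   absorbs the prediction:
     F (eta_t s_{1:t}) <= F (eta_t s_{1:t-1}) + eta_t <g_t, s_t> + L/2 (eta_t |s_t - m_t|)^2.
   The fixed point condition makes <g_t, s_t> vanish. If <g_t, 1> = 0 it vanishes as well, because
   F <= 0 on the negative orthant forces g_t >= 0 and hence g_t = 0. Finally F 0 <= 0 and convexity
   give F (c v) <= c F v for 0 <= c <= 1, which handles the change of step size. *)
theory Submission
  imports Defs
begin

text \<open>Restricting \<open>F\<close> to the line through \<open>x\<close> and \<open>y\<close>
  reduces this to the one-dimensional tangent inequality at 0, evaluated at 1.\<close>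

lemma convex_on_imp_above_tangent_gderiv:
  fixes F :: "'v::real_inner \<Rightarrow> real"
  assumes conv: "convex_on UNIV F" and deriv: "GDERIV F x :> D"
  shows "F x + D \<bullet> (y - x) \<le> F y"
proof -
  define f where "f u = F (x + u *\<^sub>R (y - x))" for u :: real
  have "convex_on UNIV f"
  proof (rule convex_onI)
    fix t u v :: real
    assume "0 < t" "t < 1"
    then have "F ((1 - t) *\<^sub>R (x + u *\<^sub>R (y - x)) + t *\<^sub>R (x + v *\<^sub>R (y - x)))
        \<le> (1 - t) * f u + t * f v"
      using convex_onD[OF conv] by (simp add: f_def)
    moreover have "(1 - t) *\<^sub>R (x + u *\<^sub>R (y - x)) + t *\<^sub>R (x + v *\<^sub>R (y - x))
        = x + ((1 - t) *\<^sub>R u + t *\<^sub>R v) *\<^sub>R (y - x)"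
      by (simp add: algebra_simps)
    ultimately show "f ((1 - t) *\<^sub>R u + t *\<^sub>R v) \<le> (1 - t) * f u + t * f v"
      by (simp add: f_def)
  qed simp
  moreover have "(f has_field_derivative D \<bullet> (y - x)) (at 0 within UNIV)"
  proof -
    have "(F has_derivative (\<lambda>h. h \<bullet> D)) (at (x + 0 *\<^sub>R (y - x)))"
      using deriv by (simp add: gderiv_def)
    moreover have "((\<lambda>u. x + u *\<^sub>R (y - x)) has_derivative (\<lambda>u. u *\<^sub>R (y - x))) (at 0)"
      by (auto intro!: derivative_eq_intros)
    ultimately have "(f has_derivative (\<lambda>u. (u *\<^sub>R (y - x)) \<bullet> D)) (at 0)"
      unfolding f_def by (rule has_derivative_compose[rotated])
    then show ?thesis
      by (simp add: has_field_derivative_def inner_commute[of D] mult_commute_abs)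
  qed
  ultimately have "f 1 - f 0 \<ge> D \<bullet> (y - x) * (1 - 0)"
    by (intro convex_on_imp_above_tangent[where A = UNIV]) auto
  then show ?thesis
    by (simp add: f_def)
qed

lemma convex_on_scaleR_le:
  fixes F :: "'v::real_vector \<Rightarrow> real"
  assumes "convex_on UNIV F" "F 0 \<le> 0" "0 \<le> c" "c \<le> 1"
  shows "F (c *\<^sub>R v) \<le> c * F v"
proof -
  have "F ((1 - c) *\<^sub>R 0 + c *\<^sub>R v) \<le> (1 - c) * F 0 + c * F v"
    using assms by (intro convex_onD) auto
  moreover have "(1 - c) * F 0 \<le> 0"
    using assms by (simp add: mult_nonneg_nonpos)
  ultimately show ?thesis
    by simp
qed

text \<open>A negative \<open>k\<close>-th slope would make the tangent plane grow without bound
  along the negative \<open>k\<close>-th axis. \<open>F\<close> dominates that plane, yet is at most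
  0 on this axis.\<close>

lemma gderiv_nonneg_of_nonpos_orthant:
  fixes F :: "real ^ 'k \<Rightarrow> real"
  assumes conv: "convex_on UNIV F" and deriv: "GDERIV F x :> D"
    and nonpos: "\<And>s. (\<And>k. s $ k \<le> 0) \<Longrightarrow> F s \<le> 0"
  shows "0 \<le> D $ k"
proof (rule ccontr)
  assume "\<not> 0 \<le> D $ k"
  then have neg: "D $ k < 0" by simp
  \<comment> \<open>The quotient makes the tangent plane at least 1 at \<open>axis k (- c)\<close>;
    the maximum with 0 keeps this point in the nonpositive orthant.\<close>
  define c where "c = max 0 ((D \<bullet> x - F x + 1) / - D $ k)"
  have "F (axis k (- c)) \<le> 0"
    by (rule nonpos) (simp add: axis_def c_def)
  then have "F x + D \<bullet> (axis k (- c) - x) \<le> 0"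
    using convex_on_imp_above_tangent_gderiv[OF conv deriv] by (rule order_trans[rotated])
  then have "c * - D $ k \<le> D \<bullet> x - F x"
    by (simp add: inner_diff_right inner_axis mult.commute)
  moreover have "(D \<bullet> x - F x + 1) / - D $ k * - D $ k \<le> c * - D $ k"
    using neg by (intro mult_right_mono) (auto simp: c_def)
  ultimately show False
    using neg by simp
qed

lemma inner_1_right: "g \<bullet> 1 = (\<Sum>k\<in>UNIV. g $ k)"
  for g :: "real ^ 'k"
  by (simp add: inner_vec_def)

text \<open>Pulling the loss out of the regret leaves \<open>g \<bullet> vec 1\<close> times the
  fixed-point defect of \<open>hedging_op phi g\<close>, so a fixed point works against every
  loss.\<close>

lemma inner_inst_regret:
  "g \<bullet> inst_regret phi l x = l \<bullet> ((g \<bullet> vec 1) *\<^sub>R x - (\<Sum>k\<in>UNIV. (g $ k) *\<^sub>R phi k x))"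
  unfolding inner_vec_def[of g "inst_regret phi l x"]
  by (simp add: inst_regret_def inner_1_right inner_diff_right inner_sum_right sum_distrib_right
      right_diff_distrib sum_subtractf)

lemma inner_inst_regret_eq_0:
  assumes nonneg: "\<And>k. 0 \<le> g $ k"
    and fixpoint: "g \<bullet> vec 1 \<noteq> 0 \<Longrightarrow> hedging_op phi g x = x"
  shows "g \<bullet> inst_regret phi l x = 0"
proof (cases "g \<bullet> vec 1 = 0")
  case True
  \<comment> \<open>Nonnegative entries with sum zero are all zero.\<close>
  then have "g = 0"
    using nonneg by (simp add: inner_1_right sum_nonneg_eq_0_iff vec_eq_iff)
  then show ?thesis by simp
next
  case False
  then have "(g \<bullet> vec 1) *\<^sub>R hedging_op phi g x = (\<Sum>k\<in>UNIV. (g $ k) *\<^sub>R phi k x)"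
    by (simp add: hedging_op_def)
  then show ?thesis
    using fixpoint[OF False] by (simp add: inner_inst_regret)
qed

lemma pos_part_scaleR: "0 \<le> c \<Longrightarrow> pos_part (c *\<^sub>R v) = c *\<^sub>R pos_part v"
  by (simp add: pos_part_def vec_eq_iff max_mult_distrib_left)

lemma hedging_step:
  fixes F :: "real ^ 'k \<Rightarrow> real"
  assumes norm: "is_norm N" and conv: "convex_on UNIV F" and diff: "\<And>s. F differentiable (at s)"
    and smooth: "positive_invariant_smooth N L F" and "0 \<le> e"
    and orth: "gradient F (e *\<^sub>R (R + p)) \<bullet> s = 0"
  shows "F (e *\<^sub>R pos_part (R + s)) \<le> F (e *\<^sub>R R) + L / 2 * (e * N (s - p))\<^sup>2"
proof -
  define z where "z = e *\<^sub>R (R + p)"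
  define g where "g = gradient F z"
  \<comment> \<open>Smoothness is expanded at the predicted point \<open>z\<close>, so the
    displacement is only the prediction error.\<close>
  have "e *\<^sub>R pos_part (R + s) = pos_part (z + e *\<^sub>R (s - p))"
    using \<open>0 \<le> e\<close> by (simp add: z_def pos_part_scaleR[symmetric] algebra_simps)
  then have "F (e *\<^sub>R pos_part (R + s)) \<le> F z + g \<bullet> (e *\<^sub>R (s - p)) + L / 2 * (N (e *\<^sub>R (s - p)))\<^sup>2"
    using smooth unfolding positive_invariant_smooth_def g_def by metis
  moreover have "N (e *\<^sub>R (s - p)) = e * N (s - p)"
    using norm \<open>0 \<le> e\<close> by (simp add: is_norm_def)
  moreover have "F z + g \<bullet> (e *\<^sub>R R - z) \<le> F (e *\<^sub>R R)"
    unfolding g_def by (intro convex_on_imp_above_tangent_gderiv conv GDERIV_gradient diff)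
  \<comment> \<open>Both sides equal \<open>- e * (g \<bullet> p)\<close>: the left one by
    \<open>orth\<close>, the right one because \<open>e *\<^sub>R R - z\<close> is
    \<open>- e *\<^sub>R p\<close>.\<close>
  moreover have "g \<bullet> (e *\<^sub>R (s - p)) = g \<bullet> (e *\<^sub>R R - z)"
    using orth by (simp add: g_def z_def scaleR_add_right scaleR_diff_right inner_simps)
  ultimately show ?thesis
    by simp
qed

theorem theorem4:
  fixes Phi :: "(real ^ 'n \<Rightarrow> real ^ 'n) set"
    and phi :: "'k::finite \<Rightarrow> real ^ 'n \<Rightarrow> real ^ 'n"
    and N :: "real ^ 'k \<Rightarrow> real"
    and F :: "real ^ 'k \<Rightarrow> real"
    and L :: real
    and T :: nat
    and \<eta> :: "nat \<Rightarrow> real"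
    and l x :: "nat \<Rightarrow> real ^ 'n"
    and m :: "nat \<Rightarrow> real ^ 'k"
  assumes "finite Phi"
    and "\<forall>f\<in>Phi. linear f \<and> f ` prob_simplex \<subseteq> prob_simplex"
    and "bij_betw phi UNIV Phi"
    and "is_norm N"
    and "convex_on UNIV F"
    and "\<forall>s. F differentiable (at s)"
    and "\<forall>s. (\<forall>k. s $ k \<le> 0) \<longrightarrow> F s \<le> 0"
    and "L > 0"
    and "positive_invariant_smooth N L F"
    and "T \<ge> 1"
    and "\<forall>t\<in>{1..<T}. \<eta> (Suc t) \<le> \<eta> t"
    and "\<eta> T > 0"
    and "plays_optimistic_hedging_plus phi F \<eta> T l m x"
  shows "F (\<eta> T *\<^sub>R mod_regret phi l x T)
    \<le> L / 2 * (\<Sum>t=1..T. \<eta> T * \<eta> t * (N (inst_regret phi (l t) (x t) - m t))\<^sup>2)"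
proof -
  note conv = assms(5)
  define R where "R = mod_regret phi l x"
  define s where "s t = inst_regret phi (l t) (x t)" for t
  \<comment> \<open>The outer step size is left out of \<open>B\<close>, so that it can vary in the
    induction, where the bound is \<open>c * B t\<close>.\<close>
  define B where "B t = L / 2 * (\<Sum>i=1..t. \<eta> i * (N (s i - m i))\<^sup>2)" for t
  have F0: "F 0 \<le> 0"
    using assms(7) by simp
  have eta_pos: "0 < \<eta> t" if "t \<in> {1..T}" for t
  proof -
    have "t \<le> T" "1 \<le> t"
      using that by auto
    then show ?thesis
    \<comment> \<open>Positivity is assumed only at \<open>T\<close> and passes down to earlier
      rounds by monotonicity.\<close>
    proof (induction t rule: inc_induct)
      case base
      show ?case by (rule assms(12))
    next
      case (step t)
      then have "\<eta> (Suc t) \<le> \<eta> t"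
        using assms(11) by simp
      then show ?case
        using step by linarith
    qed
  qed
  have step: "F (\<eta> (Suc t) *\<^sub>R R (Suc t))
      \<le> F (\<eta> (Suc t) *\<^sub>R R t) + L / 2 * (\<eta> (Suc t) * N (s (Suc t) - m (Suc t)))\<^sup>2"
    if "Suc t \<le> T" for t
  proof -
    define g where "g = hedging_grad phi F \<eta> l m x (Suc t)"
    have "0 \<le> g $ k" for k
      unfolding g_def hedging_grad_def
      using assms(6,7) by (intro gderiv_nonneg_of_nonpos_orthant[OF conv GDERIV_gradient]) auto
    moreover have "hedging_op phi g (x (Suc t)) = x (Suc t)" if "g \<bullet> vec 1 \<noteq> 0"
      using assms(13) that \<open>Suc t \<le> T\<close> by (simp add: plays_optimistic_hedging_plus_def g_def)
    ultimately have "g \<bullet> s (Suc t) = 0"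
      unfolding s_def by (rule inner_inst_regret_eq_0)
    then show ?thesis
      using hedging_step[OF assms(4) conv _ assms(9), of "\<eta> (Suc t)" "R t" "m (Suc t)" "s (Suc t)"]
        assms(6) eta_pos[of "Suc t"] that
      by (simp add: R_def s_def g_def hedging_grad_def)
  qed
  \<comment> \<open>Allowing every step size below \<open>\<eta> t\<close> lets the induction hypothesis absorb the change of step size.\<close>
  have "F (c *\<^sub>R R t) \<le> c * B t" if "t \<le> T" "0 < c" "t = 0 \<or> c \<le> \<eta> t" for t c
    using that
  proof (induction t arbitrary: c)
    case 0
    show ?case using F0 by (simp add: R_def B_def)
  next
    case (Suc t)
    define e where "e = \<eta> (Suc t)"
    have e: "0 < e" "c \<le> e"
      using eta_pos[of "Suc t"] Suc.prems by (auto simp: e_def)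
    \<comment> \<open>Monotonicity starts at round 1, hence the exemption for \<open>t = 0\<close>,
      where \<open>R 0 = 0\<close> makes any scale harmless.\<close>
    have "t = 0 \<or> e \<le> \<eta> t"
      using assms(11) Suc.prems by (auto simp: e_def)
    then have "F (e *\<^sub>R R t) \<le> e * B t"
      using Suc.prems e by (intro Suc.IH) auto
    \<comment> \<open>The new weight is \<open>e * \<eta> (Suc t)\<close>, which is the square of
      \<open>e\<close> and matches the error term of \<open>step\<close>.\<close>
    moreover have "e * B (Suc t) = e * B t + L / 2 * (e * N (s (Suc t) - m (Suc t)))\<^sup>2"
      by (simp add: B_def e_def power2_eq_square algebra_simps)
    ultimately have bound: "F (e *\<^sub>R R (Suc t)) \<le> e * B (Suc t)"
      using step[of t] Suc.prems by (simp add: e_def)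
    \<comment> \<open>The bound at scale \<open>e\<close> is contracted to scale \<open>c\<close> by
      the factor \<open>c / e\<close>, which is at most 1.\<close>
    have "F (c *\<^sub>R R (Suc t)) = F ((c / e) *\<^sub>R e *\<^sub>R R (Suc t))"
      using e by simp
    also have "\<dots> \<le> c / e * F (e *\<^sub>R R (Suc t))"
      using e Suc.prems by (intro convex_on_scaleR_le conv F0) auto
    also have "\<dots> \<le> c / e * (e * B (Suc t))"
      using e Suc.prems by (intro mult_left_mono bound) auto
    finally show ?case
      using e by simp
  qed
  from this[of T "\<eta> T"] show ?thesis
    using assms(12) by (simp add: R_def B_def s_def sum_distrib_left mult_ac)
qed

end
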